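(* Let $n \in \mathbb{N}_0$. Then for all $z \in \mathbb{C}$ with $\max(2n,1) < \operatorname{Re}(z) < 2n+2$, $$\zeta(z) = (z/2)\, \pi^{z-1} \sin (\pi z/2) \int_0^\infty t^{-z/2-1} \, [F(t) - F_n(t)]\, dt .$$ In particular, $$\zeta(3) = -3 \pi^2 \int_0^\infty s^{-4} \big[F(s^2) - F_1(s^2)\big]\, ds = -3 \pi^2 \int_0^\infty s^{-4} \Big[\ln \big(s^{-1}\sinh(s)\big) - \frac{s^2}{6}\Big]\, ds,$$ $$\zeta(5) = 5 \pi^4 \int_0^\infty s^{-6} \big[F(s^2) - F_2(s^2)\big]\, ds = 5 \pi^4 \int_0^\infty s^{-6} \Big[\ln\big(s^{-1}\sinh(s)\big) - \frac{s^2}{6} + \frac{s^4}{180}\Big]\, ds,$$ $$\zeta(7) = -7 \pi^6 \int_0^\infty s^{-8} \big[F(s^2) - F_3(s^2)\big]\, ds = -7 \pi^6 \int_0^\infty s^{-8} \Big[\ln \big(s^{-1}\sinh(s)\big) - \frac{s^2}{6} + \frac{s^4}{180} - \frac{s^6}{2835}\Big]\, ds.$$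
   Context: $\mathbb{N} = \{1,2,3,\dots\}$, $\mathbb{N}_0 = \mathbb{N} \cup \{0\}$. $\zeta$ is the Riemann zeta function, $\zeta(z) = \sum_{k \in \mathbb{N}} k^{-z}$ for $\operatorname{Re}(z) > 1$. For $t > 0$, $$F(t) = \ln \big(t^{-1/2} \sinh\big(t^{1/2}\big)\big)$$ (real logarithm; near $t=0$ one has the expansion $F(t) = \sum_{k=1}^\infty \frac{2^{2k} B_{2k}}{2k\, (2k)!} t^k$), and $$F_n(t) = \sum_{k=1}^n \frac{2^{2k} B_{2k}}{2k\, (2k)!}\, t^k, \quad n \in \mathbb{N}, \qquad F_0(t) = 0,$$ where $B_m$ are the Bernoulli numbers, generated by $\frac{w}{e^w-1} = \sum_{m \in \mathbb{N}_0} B_m \frac{w^m}{m!}$, $|w| < 2\pi$. Powers of positive numbers such as $t^{-z/2-1}$ are defined by $x^{w} = e^{w \ln x}$ with the real logarithm. *)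

theory Defs
  imports "HOL-Complex_Analysis.Complex_Analysis"
begin

text \<open>The Dirichlet series of the Riemann zeta function; it represents the zeta function only for
  \<open>Re z > 1\<close>, and no continuation is built in.\<close>

definition zeta :: "complex \<Rightarrow> complex" where
  "zeta z = (\<Sum>k. of_nat (Suc k) powr (- z))"

text \<open>The Bernoulli numbers with \<open>B\<^sub>1 = -1/2\<close>, read off the formal power series of \<open>w / (e\<^sup>w - 1)\<close>.
  The denominator has zero constant term, but division of formal power series cancels the common
  factor \<open>w\<close>. Lemma \<open>bernoulli_sums\<close> below is the analytic form of the generating function.\<close>

definition bernoulli :: "nat \<Rightarrow> real" where
  "bernoulli m = fact m * fps_nth (fps_X / (fps_exp 1 - 1)) m"

lemma bernoulli_sums:
  fixes w :: complex
  assumes "w \<noteq> 0" "norm w < 2 * pi"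
  shows "(\<lambda>m. of_real (bernoulli m) * w ^ m / fact m) sums (w / (exp w - 1))"
proof -
  define R :: "real fps" where "R = fps_X / (fps_exp 1 - 1)"
  define C :: "complex fps" where "C = Abs_fps (\<lambda>m. of_real (fps_nth R m))"
  define f where "f = (\<lambda>w::complex. if w = 0 then 1 else w / (exp w - 1))"
  have sub: "subdegree (fps_exp (1::real) - 1) = 1" "subdegree (fps_exp (1::complex) - 1) = 1"
      "subdegree (1 - fps_exp (1::complex)) = 1"
    by (auto intro!: subdegreeI)
  have ne: "fps_exp (1::real) - 1 \<noteq> 0" "fps_exp (1::complex) - 1 \<noteq> 0"
    using sub by (metis subdegree_0 zero_neq_one)+
  have R: "R * (fps_exp 1 - 1) = fps_X"
    unfolding R_def by (rule dvd_div_mult_self) (use ne sub in \<open>auto simp: fps_dvd_iff\<close>)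
  have C: "C * (fps_exp 1 - 1) = fps_X"
  proof (rule fps_ext)
    fix n
    have "fps_nth (C * (fps_exp 1 - 1)) n = of_real (fps_nth (R * (fps_exp 1 - 1)) n)"
      by (simp add: fps_mult_nth C_def del: fps_sub_nth)
         (rule sum.cong, auto simp: C_def)
    thus "fps_nth (C * (fps_exp 1 - 1)) n = fps_nth fps_X n"
      by (simp add: R fps_X_def)
  qed
  have nz: "exp v - 1 \<noteq> 0" if "v \<noteq> 0" "norm v < 2 * pi" for v :: complex
  proof
    assume "exp v - 1 = 0"
    then obtain n :: int where n: "Re v = 0" "Im v = of_int (2 * n) * pi"
      by (auto simp: exp_eq_1)
    with that have "n \<noteq> 0" by (auto simp: complex_eq_iff)
    hence "1 \<le> \<bar>of_int n :: real\<bar>" by linarith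
    hence "2 * pi \<le> \<bar>Im v\<bar>" using n by (simp add: abs_mult)
    with abs_Im_le_cmod[of v] that show False by linarith
  qed
  have fe: "f has_fps_expansion (fps_X / (fps_exp 1 - 1))"
    unfolding f_def
    by (rule has_fps_expansion_divide) (auto intro!: fps_expansion_intros simp: sub ne)
  have E: "fps_X / (fps_exp 1 - 1) = C"
    by (metis C ne nonzero_mult_div_cancel_right)
  have hol: "f holomorphic_on eball 0 (ereal (2 * pi))"
  proof -
    have "f analytic_on {0}" using fe by (rule has_fps_expansion_imp_analytic_0)
    moreover have "f analytic_on {v}" if "v \<noteq> 0" "norm v < 2 * pi" for v
    proof -
      have "(\<lambda>w. w / (exp w - 1)) analytic_on {v}"
        using nz that by (intro analytic_intros) auto
      moreover have "eventually (\<lambda>x. f x = x / (exp x - 1)) (nhds v)"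
        using t1_space_nhds[OF that(1)] by eventually_elim (auto simp: f_def)
      ultimately show ?thesis by (subst analytic_at_cong) auto
    qed
    ultimately have "f analytic_on {v}" if "norm v < 2 * pi" for v
      using that by (cases "v = 0") auto
    hence "f analytic_on eball 0 (ereal (2 * pi))"
      by (subst analytic_on_analytic_at) (auto simp: eball_def)
    thus ?thesis by (rule analytic_imp_holomorphic)
  qed
  have "(\<lambda>n. fps_nth C n * w ^ n) sums f w"
    using has_fps_expansion_imp_sums_complex[OF fe hol, of w] assms E by simp
  thus ?thesis
    using assms by (simp add: bernoulli_def C_def R_def f_def)
qed
text \<open>Meaningful for \<open>t > 0\<close> only.\<close>

definition F :: "real \<Rightarrow> real" where
  "F t = ln (t powr (- 1 / 2) * sinh (t powr (1 / 2)))"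

definition F_part :: "nat \<Rightarrow> real \<Rightarrow> real" where
  "F_part n t = (\<Sum>k = 1..n. 2 ^ (2 * k) * bernoulli (2 * k) / (2 * real k * fact (2 * k)) * t ^ k)"

end

theory Submission
  imports Defs "HOL-Real_Asymp.Real_Asymp"
begin

text \<open>
  Euler's product \<open>sinh x / x = \<Prod>\<^sub>j (1 + x\<^sup>2 / c\<^sub>j)\<close> with \<open>c\<^sub>j = \<pi>\<^sup>2 j\<^sup>2\<close>, \<open>j \<ge> 1\<close>, gives
  \<open>F(t) = \<Sum>\<^sub>j ln (1 + t / c\<^sub>j)\<close>. Let \<open>L\<^sub>n(u)\<close> be the difference of \<open>ln (1 + u)\<close> and its Taylor
  polynomial of degree \<open>n\<close>. Since \<open>F\<^sub>n\<close> is the Taylor polynomial of \<open>F\<close>, it follows that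
  \<open>F(t) - F\<^sub>n(t) = \<Sum>\<^sub>j L\<^sub>n(t / c\<^sub>j)\<close> for every \<open>t > 0\<close> (\<open>ln1p_remainder_sums\<close>): up to
  its Taylor polynomial, \<open>F\<close> is a sum of dilates of the single function \<open>L\<^sub>n\<close>.

  The Mellin transform multiplies a dilate by a power of its dilation factor, so the integral in
  question is \<open>\<Sum>\<^sub>j c\<^sub>j powr (-z / 2) = \<pi> powr (-z) * \<zeta>(z)\<close> times the Mellin transform of \<open>L\<^sub>n\<close> at
  \<open>-z / 2\<close>. The latter converges exactly when \<open>2 n < Re z < 2 n + 2\<close> and equals
  \<open>\<pi> / (s sin (\<pi> s))\<close> at \<open>s = -z / 2\<close> (\<open>has_mellin_ln1p_remainder\<close>); solving for \<open>\<zeta>(z)\<close> proves the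
  formula.

  One consequence of Fubini's theorem, \<open>mellin_superposition\<close>, does the work three times. It yields
  the transform of \<open>1 / (1 + u)\<close> as a product of two values of the Gamma function, the passage from
  \<open>L\<^sub>n'(u) = (-u)\<^sup>n / (1 + u)\<close> to \<open>L\<^sub>n\<close>, and finally the sum over \<open>j\<close>.

  That the Bernoulli numbers in \<open>F\<^sub>n\<close> are the right Taylor coefficients is Euler's evaluation of the
  zeta function at even integers. It is proved here (\<open>bernoulli_eq_root_power_sum\<close>) by comparing
  two expansions of \<open>F'\<close>. The values at \<open>3\<close>, \<open>5\<close> and \<open>7\<close> follow by the substitution \<open>t = s\<^sup>2\<close>.
\<close>

section \<open>Mellin transforms\<close>

text \<open>
  Convergence and value are one statement here: a Bochner integral that does not exist has the
  value \<open>0\<close>, so an equation about values alone would say nothing. The integrand is a real function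
  because every function transformed below is real; only the exponent is complex.
\<close>

definition has_mellin :: "(real \<Rightarrow> real) \<Rightarrow> complex \<Rightarrow> complex \<Rightarrow> bool" where
  "has_mellin f s I \<longleftrightarrow> has_bochner_integral lborel
     (\<lambda>t. indicator {0<..} t *\<^sub>R (of_real t powr (s - 1) * of_real (f t))) I"

lemma has_mellin_cong:
  assumes "\<And>t. t > 0 \<Longrightarrow> f t = g t" "s = s'" "I = I'"
  shows "has_mellin f s I \<longleftrightarrow> has_mellin g s' I'"
  unfolding has_mellin_def using assms
  by (intro has_bochner_integral_cong) (auto simp: indicator_def)

lemma of_real_powr_eq_exp_ln:
  assumes "x > 0"
  shows "complex_of_real x powr w = exp (w * of_real (ln x))"
  using assms by (simp add: powr_def Ln_of_real)

lemma of_real_divide_powr: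
  assumes "x > 0" "y > 0"
  shows "complex_of_real (x / y) powr w = of_real x powr w / of_real y powr w"
  unfolding of_real_powr_eq_exp_ln[OF assms(1)] of_real_powr_eq_exp_ln[OF assms(2)]
    of_real_powr_eq_exp_ln[OF divide_pos_pos[OF assms]]
  using assms by (simp add: ln_div right_diff_distrib exp_diff)

lemma has_bochner_integral_scale:
  fixes I :: "'b :: {banach, second_countable_topology}"
  assumes "c > 0" "has_bochner_integral lborel g I"
  shows "has_bochner_integral lborel (\<lambda>u. g (u / c)) (c *\<^sub>R I)"
  using assms lborel_has_bochner_integral_real_affine_iff[of "1 / c" g I 0] by simp

text \<open>
  The transform of a dilate \<open>u \<mapsto> k (u / c)\<close> is \<open>c\<^sup>s\<close> times the transform of \<open>k\<close>. By Fubini's theorem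
  the transform of a weighted superposition of dilates therefore factors into the transform of \<open>k\<close>
  and a generalised Dirichlet series in the dilation factors. The measure \<open>M\<close> is kept arbitrary
  because the lemma is used both for Lebesgue measure (to build \<open>1 / (1 + u)\<close> and primitives) and
  for counting measure on the natural numbers (to sum over the zeros of \<open>sinh\<close>). Integrability in
  \<open>x\<close> for a fixed \<open>u\<close> is part of the conclusion of Fubini's theorem only almost everywhere; where it
  fails, the inner integral is \<open>0\<close> by convention, which does not affect the outer one. Positivity of
  the dilation factors is demanded on the support of the weight only, so that a weight living on a
  half-line can be used with \<open>M = lborel\<close>.
\<close>

lemma mellin_superposition:
  fixes c f :: "'a \<Rightarrow> real"
  assumes "sigma_finite_measure M"
    and [measurable]: "c \<in> borel_measurable M" 
    and pos: "\<And>x. f x \<noteq> 0 \<Longrightarrow> c x > 0"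
    and k: "has_mellin k s K"
    and f: "has_bochner_integral M (\<lambda>x. of_real (c x) powr s * of_real (f x)) J"
  shows "has_mellin (\<lambda>u. LINT x|M. k (u / c x) * f x) s (J * K)"
proof -
  interpret sigma_finite_measure M by fact
  interpret pair_sigma_finite M lborel by unfold_locales
  define g where "g = (\<lambda>t. indicator {0<..} t *\<^sub>R (of_real t powr (s - 1) * complex_of_real (k t)))"
  define w where "w = (\<lambda>x. of_real (c x) powr s * complex_of_real (f x))"
  \<comment> \<open>This is the integrand on the product space, written in terms of the two given integrands
    so that its measurability comes from theirs.\<close>
  define h where "h = (\<lambda>x u. w x * of_real (1 / c x) * g (u / c x))"
  have g: "has_bochner_integral lborel g K" using k unfolding has_mellin_def g_def .
  have w: "has_bochner_integral M w J" using f unfolding w_def .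
  have [measurable]: "g \<in> borel_measurable borel" using g
    by (auto dest: borel_measurable_has_bochner_integral)
  have [measurable]: "w \<in> borel_measurable M" using w
    by (auto dest: borel_measurable_has_bochner_integral)
  have w0: "w x = 0" if "\<not> c x > 0" for x using pos that by (auto simp: w_def)
  have inner: "has_bochner_integral lborel (h x) (w x * K)" for x
  proof (cases "c x > 0")
    case True
    thus ?thesis using has_bochner_integral_mult_right[OF has_bochner_integral_scale[OF True g], of "w x * of_real (1 / c x)"]
      by (simp add: h_def field_simps scaleR_conv_of_real)
  qed (simp add: h_def w0 has_bochner_integral_zero)
  have inner_norm: "has_bochner_integral lborel (\<lambda>u. norm (h x u)) (norm (w x) * (LINT t|lborel. norm (g t)))" for x
  proof (cases "c x > 0")
    case True
    have "has_bochner_integral lborel (\<lambda>t. norm (g t)) (LINT t|lborel. norm (g t))"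
      using g by (simp add: has_bochner_integral_iff)
    from has_bochner_integral_mult_right[OF has_bochner_integral_scale[OF True this], of "norm (w x) / c x"] True
    show ?thesis by (simp add: h_def norm_mult norm_divide field_simps)
  qed (simp add: h_def w0 has_bochner_integral_zero)
  have hint: "integrable (M \<Otimes>\<^sub>M lborel) (case_prod h)"
  proof (rule Fubini_integrable)
    show "case_prod h \<in> borel_measurable (M \<Otimes>\<^sub>M lborel)"
      unfolding h_def by measurable
    show "integrable M (\<lambda>x. LINT u|lborel. norm (case_prod h (x, u)))"
      using w by (auto simp: has_bochner_integral_integral_eq[OF inner_norm] has_bochner_integral_iff)
    show "AE x in M. integrable lborel (\<lambda>u. case_prod h (x, u))"
      using inner by (auto simp: has_bochner_integral_iff)
  qed
  have "(LINT u|lborel. LINT x|M. h x u) = (LINT x|M. LINT u|lborel. h x u)"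
    by (rule Fubini_integral[OF hint])
  also have "\<dots> = (LINT x|M. w x * K)"
    by (simp add: has_bochner_integral_integral_eq[OF inner])
  also have "\<dots> = J * K"
    using has_bochner_integral_mult_left[OF w, of K] by (simp add: has_bochner_integral_iff)
  finally have main: "has_bochner_integral lborel (\<lambda>u. LINT x|M. h x u) (J * K)"
    using integrable_snd[OF hint] by (simp add: has_bochner_integral_iff)
  have heq: "h x u = of_real (k (u / c x) * f x) * (indicator {0<..} u *\<^sub>R of_real u powr (s - 1))"
      for x u
  proof (cases "c x > 0")
    case c: True
    show ?thesis
    proof (cases "u > 0")
      case True
      have "of_real (u / c x) powr (s - 1) = of_real u powr (s - 1) / of_real (c x) powr (s - 1)"
        using c True by (rule of_real_divide_powr[rotated])
      moreover have "of_real (c x) powr s = of_real (c x) powr (s - 1) * of_real (c x)"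
        using c by (simp add: powr_diff)
      ultimately show ?thesis using c True by (simp add: h_def g_def w_def)
    next
      case False
      thus ?thesis using c by (simp add: h_def g_def zero_less_divide_iff)
    qed
  next
    case False
    thus ?thesis using pos[of x] by (auto simp: h_def w0)
  qed
  have "(LINT x|M. h x u) = indicator {0<..} u *\<^sub>R (of_real u powr (s - 1) * of_real (LINT x|M. k (u / c x) * f x))" for u
    unfolding heq
    by (subst integral_mult_left_zero, subst integral_complex_of_real)
        (simp add: scaleR_conv_of_real)
  thus ?thesis using main unfolding has_mellin_def by simp
qed

text \<open>
  Euler's integral for the Gamma function, carried over from the gauge integral to \<open>lborel\<close>.
\<close>

lemma has_mellin_exp_minus:
  assumes "Re s > 0"
  shows "has_mellin (\<lambda>t. exp (- t)) s (Gamma s)"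
proof -
  let ?g = "\<lambda>t. complex_of_real t powr (s - 1) / of_real (exp t)"
  have eq: "indicator {0<..} t *\<^sub>R (complex_of_real t powr (s - 1) * of_real (exp (- t)))
      = indicator {0<..} t *\<^sub>R ?g t" for t
    by (simp add: exp_minus field_simps)
  have meas: "(\<lambda>t. indicator {0<..} t *\<^sub>R ?g t) \<in> borel_measurable borel"
  proof -
    have "(\<lambda>t. indicator {0<..} t *\<^sub>R ?g t)
        = (\<lambda>t. indicator {0<..} t *\<^sub>R (exp (of_real (ln t) * (s - 1)) / of_real (exp t)))"
      by (auto simp: fun_eq_iff indicator_def powr_def Ln_of_real mult.commute)
    also have "\<dots> \<in> borel_measurable borel" by measurable
    finally show ?thesis .
  qed
  have abs: "?g absolutely_integrable_on {0<..}"
      by (rule absolutely_integrable_Gamma_integral'[OF assms])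
  hence "integrable lborel (\<lambda>t. indicator {0<..} t *\<^sub>R ?g t)"
    using meas by (simp add: set_integrable_def integrable_completion)
  moreover have "(LINT t|lborel. indicator {0<..} t *\<^sub>R ?g t) = (LINT t:{0<..}|lebesgue. ?g t)"
    using meas by (simp add: set_lebesgue_integral_def integral_completion)
  moreover have "(LINT t:{0<..}|lebesgue. ?g t) = integral {0<..} ?g"
    by (rule set_lebesgue_integral_eq_integral(2)[OF abs])
  moreover have "integral {0<..} ?g = Gamma s"
    using Gamma_integral_complex'[OF assms] by (rule integral_unique)
  ultimately show ?thesis unfolding has_mellin_def eq by (simp add: has_bochner_integral_iff)
qed

lemma has_bochner_integral_exp_minus:
  fixes a :: real
  assumes "a > 0"
  shows "has_bochner_integral lborel (\<lambda>y. exp (- a * y) * indicator {0<..} y) (1 / a)"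
proof -
  have "(\<integral>\<^sup>+y. ennreal (exp (- a * y)) * indicator {0..} y \<partial>lborel)
      = ennreal (0 - (- exp (- a * 0) / a))"
  proof (rule nn_integral_FTC_atLeast)
    show "((\<lambda>y. - exp (- a * y) / a) \<longlongrightarrow> 0) at_top" using assms by real_asymp
    show "((\<lambda>y. - exp (- a * y) / a) has_real_derivative exp (- a * y)) (at y)" for y
      using assms by (auto intro!: derivative_eq_intros)
  qed auto
  also have "(\<integral>\<^sup>+y. ennreal (exp (- a * y)) * indicator {0..} y \<partial>lborel) =
      (\<integral>\<^sup>+y. ennreal (exp (- a * y) * indicator {0..} y) \<partial>lborel)"
    by (intro nn_integral_cong) (auto simp: indicator_def)
  finally have "has_bochner_integral lborel (\<lambda>y. exp (- a * y) * indicator {0..} y) (1 / a)"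
    using assms by (intro has_bochner_integral_nn_integral) auto
  also have "?this \<longleftrightarrow> ?thesis"
    by (intro has_bochner_integral_cong_AE eventually_mono[OF AE_lborel_singleton[of 0]])
        (auto simp: indicator_def)
  finally show ?thesis .
qed

text \<open>
  Since \<open>1 / (1 + u)\<close> is the integral of \<open>e\<^sup>-\<^sup>u\<^sup>y e\<^sup>-\<^sup>y\<close> over \<open>y > 0\<close>, it is a superposition of dilates
  of \<open>e\<^sup>-\<^sup>u\<close> with dilation factors \<open>1 / y\<close> and weight \<open>e\<^sup>-\<^sup>y\<close>. Its transform is \<open>\<Gamma>(1 - a) \<Gamma>(a)\<close>, which
  the reflection formula evaluates.
\<close>

lemma has_mellin_inverse_one_plus:
  assumes "0 < Re a" "Re a < 1"
  shows "has_mellin (\<lambda>u. 1 / (1 + u)) a (of_real pi / sin (of_real pi * a))"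
proof -
  define f where "f = (\<lambda>y::real. indicator {0<..} y * exp (- y))"
  have *: "has_mellin (\<lambda>u. LINT y|lborel. exp (- (u / (1 / y))) * f y) a (Gamma (1 - a) * Gamma a)"
  proof (rule mellin_superposition)
    show "has_mellin (\<lambda>t. exp (- t)) a (Gamma a)" using assms by (intro has_mellin_exp_minus)
    have "has_mellin (\<lambda>t. exp (- t)) (1 - a) (Gamma (1 - a))" using assms
        by (intro has_mellin_exp_minus) simp
    also have "?this \<longleftrightarrow> has_bochner_integral lborel (\<lambda>y. of_real (1 / y) powr a * complex_of_real (f y)) (Gamma (1 - a))"
      unfolding has_mellin_def
    proof (intro has_bochner_integral_cong refl)
      fix y :: real
      show "indicator {0<..} y *\<^sub>R (complex_of_real y powr (1 - a - 1) * complex_of_real (exp (- y))) =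
         complex_of_real (1 / y) powr a * complex_of_real (f y)"
        by (cases "y > 0") (auto simp: f_def indicator_def powr_def Ln_of_real ln_div simp flip: of_real_divide)
    qed
    finally show "has_bochner_integral lborel (\<lambda>y. of_real (1 / y) powr a * complex_of_real (f y)) (Gamma (1 - a))" .
  qed (auto simp: f_def indicator_def lborel.sigma_finite_measure_axioms split: if_splits)
  have int: "(LINT y|lborel. exp (- (u / (1 / y))) * f y) = 1 / (1 + u)" if "u > 0" for u
  proof -
    have "has_bochner_integral lborel (\<lambda>y. exp (- (1 + u) * y) * indicator {0<..} y) (1 / (1 + u))"
      using that by (intro has_bochner_integral_exp_minus) simp
    moreover have "exp (- (1 + u) * y) * indicator {0<..} y = exp (- (u / (1 / y))) * f y" for y
      by (simp add: f_def indicator_def algebra_simps flip: exp_add)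
    ultimately show ?thesis by (simp add: has_bochner_integral_iff)
  qed
  have "Gamma (1 - a) * Gamma a = of_real pi / sin (of_real pi * a)"
    using Gamma_reflection_complex[of a] by (simp add: mult.commute)
  thus ?thesis using * int by (subst has_mellin_cong[where g
      = "\<lambda>u. LINT y|lborel. exp (- (u / (1 / y))) * f y"]) auto
qed

section \<open>The Taylor remainders of the logarithm\<close>

lemma has_mellin_indicator_Ioi:
  assumes "Re s < 0"
  shows "has_mellin (indicator {1<..}) s (- 1 / s)"
proof -
  have ein: "einterval 1 \<infinity> = {1::real<..}" by (simp add: one_ereal_def)
  have s0: "s \<noteq> 0" using assms by auto
  let ?g = "\<lambda>x. complex_of_real x powr (s - 1)"
  have int: "set_integrable lborel (einterval 1 \<infinity>) ?g"
    unfolding ein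
  proof (rule set_integrable_bound)
    have "(\<lambda>x. x powr (Re s - 1)) integrable_on {1::real..}"
      using has_integral_powr_to_inf[of "Re s - 1" 1] assms by (auto simp: integrable_on_def)
    hence "(\<lambda>x. x powr (Re s - 1)) absolutely_integrable_on {1::real..}"
      by (intro nonnegative_absolutely_integrable_1) auto
    hence "set_integrable lebesgue {1<..} (\<lambda>x::real. x powr (Re s - 1))"
      by (rule set_integrable_subset) auto
    thus "set_integrable lborel {1<..} (\<lambda>x::real. x powr (Re s - 1))"
      by (simp add: set_integrable_def integrable_completion)
    have "set_borel_measurable lborel {1<..} (\<lambda>x. exp ((s - 1) * of_real (ln x)))"
      by (simp add: set_borel_measurable_def)
    also have "?this \<longleftrightarrow> set_borel_measurable lborel {1<..} ?g"
      unfolding set_borel_measurable_def by (intro measurable_cong)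
          (auto simp: indicator_def of_real_powr_eq_exp_ln)
    finally show "set_borel_measurable lborel {1<..} ?g" .
  qed (auto simp: norm_powr_real_powr)
  have "(LBINT x=1..\<infinity>. ?g x) = 0 - 1 / s"
  proof (rule interval_integral_FTC_integrable)
    show "((\<lambda>x. of_real x powr s / s) has_vector_derivative ?g x) (at x)" if "1 < ereal x" for x
      using that s0 by (auto intro!: derivative_eq_intros has_vector_derivative_real_field simp: one_ereal_def)
    show "isCont ?g x" if "1 < ereal x" for x
      using that by (auto intro!: continuous_intros simp: one_ereal_def)
    have "((\<lambda>x. of_real x powr s / s) \<longlongrightarrow> 1 powr s / s) (at_right (1::real))"
      using s0 by (intro tendsto_intros) (auto intro!: tendsto_eq_intros)
    thus "(((\<lambda>x. complex_of_real x powr s / s) \<circ> real_of_ereal) \<longlongrightarrow> 1 / s) (at_right 1)"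
      by (simp add: one_ereal_def ereal_tendsto_simps)
    have "((\<lambda>x. of_real x powr s / s) \<longlongrightarrow> 0) at_top"
    proof (rule tendsto_norm_zero_cancel)
      have "((\<lambda>x::real. x powr Re s / norm s) \<longlongrightarrow> 0 / norm s) at_top"
        using assms s0 by (intro tendsto_intros tendsto_neg_powr) (auto simp: filterlim_ident)
      thus "((\<lambda>x. norm (complex_of_real x powr s / s)) \<longlongrightarrow> 0) at_top"
        by (subst tendsto_cong[where g = "\<lambda>x. x powr Re s / norm s"])
           (auto simp: norm_divide norm_powr_real_powr intro!: eventually_mono[OF eventually_gt_at_top[of 0]])
    qed
    thus "(((\<lambda>x. complex_of_real x powr s / s) \<circ> real_of_ereal) \<longlongrightarrow> 0) (at_left \<infinity>)"
      by (simp add: ereal_tendsto_simps)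
  qed (use int in auto)
  hence "has_bochner_integral lborel (\<lambda>x. indicator {1<..} x *\<^sub>R ?g x) (- 1 / s)"
    using int by (simp add: interval_lebesgue_integral_def set_integrable_def
        set_lebesgue_integral_def ein has_bochner_integral_iff)
  also have "?this \<longleftrightarrow> ?thesis"
    unfolding has_mellin_def by (intro has_bochner_integral_cong) (auto simp: indicator_def)
  finally show ?thesis .
qed

text \<open>
  This replaces integration by parts, and no boundary terms have to be controlled: the primitive
  vanishing at \<open>0\<close> is the superposition, with weight \<open>f x\<close>, of the dilates by \<open>x\<close> of the unit step
  at \<open>1\<close>, whose transform is \<open>-1/s\<close>.
\<close>

lemma has_mellin_primitive:
  assumes "has_mellin f (s + 1) I" "Re s < 0"
  shows "has_mellin (\<lambda>u. LINT x|lborel. f x * indicator {0<..<u} x) s (- I / s)"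
proof -
  have "has_mellin (\<lambda>u. LINT x|lborel. indicator {1<..} (u / x) * (indicator {0<..} x * f x)) s (I * (- 1 / s))"
  proof (rule mellin_superposition)
    show "has_mellin (indicator {1<..}) s (- 1 / s)" by (rule has_mellin_indicator_Ioi) fact
    show "has_bochner_integral lborel (\<lambda>x. of_real x powr s * complex_of_real (indicator {0<..} x * f x)) I"
      using assms(1) unfolding has_mellin_def
      by (rule back_subst[of "\<lambda>g. has_bochner_integral lborel g I"])
          (auto simp: fun_eq_iff indicator_def)
  qed (auto simp: indicator_def lborel.sigma_finite_measure_axioms split: if_splits)
  also have "(\<lambda>u. LINT x|lborel. indicator {1<..} (u / x) * (indicator {0<..} x * f x))
           = (\<lambda>u. LINT x|lborel. f x * indicator {0<..<u} x)"
    by (intro ext Bochner_Integration.integral_cong) (auto simp: indicator_def field_simps)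
  finally show ?thesis by simp
qed

lemma has_mellin_power_times:
  assumes "has_mellin f (s + of_nat n) I"
  shows "has_mellin (\<lambda>x. x ^ n * f x) s I"
proof -
  have "complex_of_real x powr (s + of_nat n - 1) = of_real x powr (s - 1) * of_real x ^ n"
      if "x > 0" for x
  proof -
    have "s + of_nat n - 1 = (s - 1) + of_nat n" by simp
    thus ?thesis using that by (simp only: powr_add powr_nat') simp
  qed
  thus ?thesis using assms unfolding has_mellin_def
    by (elim back_subst[of "\<lambda>g. has_bochner_integral lborel g I"])
        (auto simp: fun_eq_iff indicator_def)
qed

lemma has_mellin_cmult:
  assumes "has_mellin f s I"
  shows "has_mellin (\<lambda>x. c * f x) s (of_real c * I)"
  using has_bochner_integral_mult_right[of "of_real c :: complex", OF assms[unfolded has_mellin_def]] unfolding has_mellin_def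
  by (simp add: algebra_simps scaleR_conv_of_real)

text \<open>
  The summation index is one less than the degree, so that the Taylor polynomial of degree \<open>n\<close> is
  subtracted; for \<open>n = 0\<close> nothing is.
\<close>

definition ln1p_remainder :: "nat \<Rightarrow> real \<Rightarrow> real" where
  "ln1p_remainder n u = ln (1 + u) - (\<Sum>k<n. (- 1) ^ k * u ^ Suc k / real (Suc k))"

lemma ln1p_remainder_has_real_derivative:
  assumes "x > -1"
  shows "(ln1p_remainder n has_real_derivative (- x) ^ n / (1 + x)) (at x)"
proof -
  have "((\<lambda>u. (- 1) ^ k * u ^ Suc k / real (Suc k)) has_real_derivative (- x) ^ k) (at x)" for k
  proof -
    have "((\<lambda>u. (- 1) ^ k * u ^ Suc k / real (Suc k)) has_real_derivative
        (- 1) ^ k * (real (Suc k) * x ^ k) / real (Suc k)) (at x)"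
      by (intro DERIV_cdivide DERIV_cmult) (use DERIV_pow[of "Suc k" x] in simp)
    also have "(- 1) ^ k * (real (Suc k) * x ^ k) / real (Suc k) = (- x) ^ k"
      by (simp add: power_minus[of x] del: of_nat_Suc)
    finally show ?thesis .
  qed
  moreover have "((\<lambda>u. ln (1 + u)) has_real_derivative 1 / (1 + x)) (at x)"
    using assms by (auto intro!: derivative_eq_intros)
  ultimately have "(ln1p_remainder n has_real_derivative 1 / (1 + x) - (\<Sum>k<n. (- x) ^ k)) (at x)"
    unfolding ln1p_remainder_def [abs_def] by (intro DERIV_diff DERIV_sum)
  also have "1 / (1 + x) - (\<Sum>k<n. (- x) ^ k) = (- x) ^ n / (1 + x)"
  proof -
    have "(\<Sum>k<n. (- x) ^ k) = (1 - (-x) ^ n) / (1 + x)"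
      using assms sum_gp_strict[of "-x" n] by auto
    thus ?thesis using assms by (simp add: field_simps)
  qed
  finally show ?thesis .
qed

lemma ln1p_remainder_0 [simp]: "ln1p_remainder n 0 = 0"
  by (simp add: ln1p_remainder_def)

lemma ln1p_remainder_integral:
  assumes "u > 0"
  shows "(LINT x|lborel. (- x) ^ n / (1 + x) * indicator {0<..<u} x) = ln1p_remainder n u"
proof -
  have "(LINT x|lborel. (- x) ^ n / (1 + x) * indicator {0..u} x)
      = ln1p_remainder n u - ln1p_remainder n 0"
    using assms ln1p_remainder_has_real_derivative by (intro integral_FTC_Icc_real)
        (auto intro!: continuous_intros)
  also have "(LINT x|lborel. (- x) ^ n / (1 + x) * indicator {0..u} x)
      = (LINT x|lborel. (- x) ^ n / (1 + x) * indicator {0<..<u} x)"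
  proof (rule integral_cong_AE)
    show "AE x in lborel. (- x) ^ n / (1 + x) * indicator {0..u} x
        = (- x) ^ n / (1 + x) * indicator {0<..<u} x"
      using AE_lborel_singleton[of 0] AE_lborel_singleton[of u]
      by eventually_elim (auto simp: indicator_def)
  qed auto
  finally show ?thesis by simp
qed

text \<open>
  The integrand \<open>(-x)\<^sup>n / (1 + x)\<close> does not change its sign for \<open>x > 0\<close>. This is what turns the
  convergence of sums of remainders into absolute convergence.
\<close>

lemma ln1p_remainder_sign:
  assumes "u \<ge> 0"
  shows "\<bar>ln1p_remainder n u\<bar> = (- 1) ^ n * ln1p_remainder n u"
proof (cases "u = 0")
  case False
  define q where "q = (\<lambda>x. (- x) ^ n / (1 + x) * indicator {0<..<u} x)"
  have "(- 1) ^ n * ln1p_remainder n u = (LINT x|lborel. (- 1) ^ n * q x)"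
    using False assms ln1p_remainder_integral[of u n] by (simp only: integral_mult_right_zero q_def)
  moreover have "0 \<le> (- 1) ^ n * q x" for x
  proof -
    have "(- 1) ^ n * q x = x ^ n / (1 + x) * indicator {0<..<u} x"
      by (simp add: q_def power_minus[of x])
    thus ?thesis by (simp add: indicator_def)
  qed
  ultimately have "0 \<le> (- 1) ^ n * ln1p_remainder n u"
    by (metis (no_types, lifting) integral_nonneg_AE AE_I2)
  thus ?thesis by (cases "even n") auto
qed simp

text \<open>
  The remainder is the primitive of \<open>(-x)\<^sup>n / (1 + x)\<close>, so that its transform comes from that of
  \<open>1 / (1 + x)\<close> at \<open>s + 1 + n\<close>. The strip for \<open>s\<close> is the one in which \<open>s + 1 + n\<close> has a real part
  strictly between \<open>0\<close> and \<open>1\<close>. All signs \<open>(-1)\<^sup>n\<close> cancel against the shift of the sine, which is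
  why the result has the same form for every \<open>n\<close>.
\<close>

lemma has_mellin_ln1p_remainder:
  assumes "- real n - 1 < Re s" "Re s < - real n"
  shows "has_mellin (ln1p_remainder n) s (of_real pi / (s * sin (of_real pi * s)))"
proof -
  have s: "Re s < 0" using assms by linarith
  have sin: "sin (of_real pi * (s + 1 + of_nat n)) = - ((- 1) ^ n * sin (of_real pi * s))"
  proof -
    have "of_real pi * (s + 1 + of_nat n) = of_real pi * s + of_real (real (Suc n) * pi)"
      by (simp add: algebra_simps)
    thus ?thesis
      by (simp only: sin_add cos_of_real sin_of_real cos_npi sin_npi) simp
  qed
  have "has_mellin (\<lambda>x. 1 / (1 + x)) (s + 1 + of_nat n) (of_real pi / sin (of_real pi * (s + 1 + of_nat n)))"
    using assms by (intro has_mellin_inverse_one_plus) auto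
  from has_mellin_cmult[OF has_mellin_power_times[OF this], of "(- 1) ^ n"]
  have "has_mellin (\<lambda>x. (- 1) ^ n * (x ^ n * (1 / (1 + x)))) (s + 1)
      ((- 1) ^ n * (of_real pi / - ((- 1) ^ n * sin (of_real pi * s))))"
    unfolding sin by simp
  also have "(\<lambda>x::real. (- 1) ^ n * (x ^ n * (1 / (1 + x)))) = (\<lambda>x. (- x) ^ n / (1 + x))"
  proof
    show "(- 1) ^ n * (x ^ n * (1 / (1 + x))) = (- x) ^ n / (1 + x)" for x :: real
      by (simp add: power_minus[of x])
  qed
  also have "(- 1) ^ n * (of_real pi / - ((- 1) ^ n * sin (of_real pi * s)))
      = - of_real pi / sin (of_real pi * s)"
    by (cases "even n") simp_all
  finally have "has_mellin (\<lambda>x. (- x) ^ n / (1 + x)) (s + 1) (- of_real pi / sin (of_real pi * s))" .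
  hence "has_mellin (\<lambda>u. LINT x|lborel. (- x) ^ n / (1 + x) * indicator {0<..<u} x) s (- (- of_real
      pi / sin (of_real pi * s)) / s)"
    by (rule has_mellin_primitive) (rule s)
  thus ?thesis
    by (subst has_mellin_cong[where g
        = "\<lambda>u. LINT x|lborel. (- x) ^ n / (1 + x) * indicator {0<..<u} x"])
       (simp_all only: ln1p_remainder_integral, simp_all add: mult.commute)
qed

section \<open>Expansion of \<open>F\<close> over the zeros of the hyperbolic sine\<close>

text \<open>
  The numbers \<open>-sinh_root_sq j\<close> are the zeros of the entire function \<open>sinh \<surd>t / \<surd>t\<close>.
\<close>

definition sinh_root_sq :: "nat \<Rightarrow> real" where
  "sinh_root_sq j = (pi * real (Suc j)) ^ 2"

lemma sinh_root_sq_ge: "sinh_root_sq j \<ge> real (Suc j) ^ 2"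
  using pi_ge_two unfolding sinh_root_sq_def by (intro power_mono) auto

lemma sinh_root_sq_pos [simp]: "sinh_root_sq j > 0"
  by (simp add: sinh_root_sq_def)

text \<open>
  The logarithm of Euler's product for the sine, taken at a purely imaginary argument.
\<close>

lemma sinh_product_sums:
  assumes "x > 0"
  shows "(\<lambda>j. ln (1 + x\<^sup>2 / sinh_root_sq j)) sums ln (sinh x / x)"
proof -
  define z where "z = \<i> * complex_of_real (x / pi)"
  define P where "P = (\<lambda>n. \<Prod>j<n. 1 + x\<^sup>2 / sinh_root_sq j)"
  have Ppos: "1 + x\<^sup>2 / sinh_root_sq j > 0" for j
    by (intro add_pos_nonneg divide_nonneg_pos) auto
  have prod: "(\<Prod>k=1..n. 1 - z\<^sup>2 / of_nat k ^ 2) = complex_of_real (P n)" for n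
  proof -
    have "(\<Prod>k=1..n. 1 - z\<^sup>2 / of_nat k ^ 2) = (\<Prod>j<n. 1 - z\<^sup>2 / of_nat (Suc j) ^ 2)"
      by (simp add: prod.atLeast1_atMost_eq)
    thus ?thesis by (simp add: P_def z_def sinh_root_sq_def power_mult_distrib power_divide)
  qed
  have "(\<lambda>n. - \<i> * (of_real pi * z * complex_of_real (P n))) \<longlonglongrightarrow> - \<i> * sin (of_real pi * z)"
    by (intro tendsto_mult tendsto_const)
        (use sin_product_formula_complex[of z] in \<open>simp only: prod\<close>)
  also have "- \<i> * sin (of_real pi * z) = complex_of_real (sinh x)"
    using sinh_conv_sin[of "complex_of_real x"] by
        (simp add: z_def sinh_field_def exp_of_real[symmetric])
  also have "(\<lambda>n. - \<i> * (of_real pi * z * complex_of_real (P n))) = (\<lambda>n. complex_of_real (x * P n))"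
    by (simp add: z_def fun_eq_iff flip: mult.assoc)
  finally have "(\<lambda>n. x * P n) \<longlonglongrightarrow> sinh x" by (simp only: tendsto_of_real_iff)
  from tendsto_divide[OF this tendsto_const[of x]] assms have "P \<longlonglongrightarrow> sinh x / x" by simp
  hence "(\<lambda>n. ln (P n)) \<longlonglongrightarrow> ln (sinh x / x)" using assms by (intro tendsto_ln) auto
  also have "(\<lambda>n. ln (P n)) = (\<lambda>n. \<Sum>j<n. ln (1 + x\<^sup>2 / sinh_root_sq j))"
    unfolding P_def using Ppos by (intro ext ln_prod)
        (auto simp: less_imp_neq[symmetric] dest: less_imp_neq)
  finally show ?thesis by (simp add: sums_def)
qed

lemma F_eq_ln_sinh_sqrt:
  assumes "t > 0"
  shows "F t = ln (sinh (sqrt t) / sqrt t)"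
  using assms by (simp add: F_def powr_half_sqrt powr_minus powr_minus_divide field_simps)

lemma F_sums:
  assumes "t > 0"
  shows "(\<lambda>j. ln (1 + t / sinh_root_sq j)) sums F t"
  using sinh_product_sums[of "sqrt t"] assms by (simp add: F_eq_ln_sinh_sqrt)

lemma ln1p_series:
  fixes u :: real
  assumes "0 \<le> u" "u < 1"
  shows "(\<lambda>k. (- 1) ^ k * u ^ Suc k / real (Suc k)) sums ln (1 + u)"
proof -
  have "summable (\<lambda>k. (- 1) ^ k * u ^ Suc k / real (Suc k))"
  proof (rule summable_comparison_test')
    show "norm ((- 1) ^ k * u ^ Suc k / real (Suc k)) \<le> u ^ k" for k
    proof -
      have "u ^ Suc k / real (Suc k) \<le> u ^ Suc k / 1" using assms by (intro divide_left_mono) auto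
      also have "\<dots> \<le> u ^ k" using assms by (simp add: mult_left_le_one_le)
      finally show ?thesis using assms by (simp add: abs_mult power_abs)
    qed
  qed (use assms in \<open>auto intro: summable_geometric\<close>)
  moreover have "ln (1 + u) = (\<Sum>k. (- 1) ^ k * u ^ Suc k / real (Suc k))"
    using ln_series[of "1 + u"] assms by simp
  ultimately show ?thesis by (simp add: sums_iff)
qed

text \<open>
  Up to the factor \<open>\<pi>\<^sup>2\<^sup>m\<close> this is \<open>\<zeta>(2m)\<close>.
\<close>

definition root_power_sum :: "nat \<Rightarrow> real" where
  "root_power_sum m = (\<Sum>j. 1 / sinh_root_sq j ^ m)"

lemma root_power_sum_sums:
  assumes "m \<ge> 1"
  shows "(\<lambda>j. 1 / sinh_root_sq j ^ m) sums root_power_sum m"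
  unfolding root_power_sum_def
proof (rule summable_sums, rule summable_comparison_test')
  show "summable (\<lambda>j. inverse (real (Suc j) ^ 2))"
    using inverse_power_summable[of 2, where ?'a = real] by (subst summable_Suc_iff) auto
  show "norm (1 / sinh_root_sq j ^ m) \<le> inverse (real (Suc j) ^ 2)" for j
  proof -
    have "1 \<le> real (Suc j) ^ 2" by simp
    hence "sinh_root_sq j \<ge> 1" using sinh_root_sq_ge[of j] by linarith
    hence "sinh_root_sq j ^ 1 \<le> sinh_root_sq j ^ m" using assms by (intro power_increasing) auto
    hence "real (Suc j) ^ 2 \<le> sinh_root_sq j ^ m" using sinh_root_sq_ge[of j] by simp
    hence "inverse (sinh_root_sq j ^ m) \<le> inverse (real (Suc j) ^ 2)"
        by (intro le_imp_inverse_le) auto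
    thus ?thesis by (simp add: divide_inverse less_imp_le[OF sinh_root_sq_pos])
  qed
qed

text \<open>
  Each logarithm is expanded into its Taylor series and the two summations are interchanged. This is
  permitted for \<open>t < 1\<close> because all \<open>sinh_root_sq j\<close> are at least \<open>1\<close>, so that
  \<open>t\<^sup>k / sinh_root_sq j\<close> dominates the term with index \<open>(j, k)\<close> of the double series.
\<close>

lemma F_power_series:
  assumes "0 < t" "t < 1"
  shows "(\<lambda>k. (- 1) ^ k / real (Suc k) * root_power_sum (Suc k) * t ^ Suc k) sums F t"
proof -
  define f where "f = (\<lambda>(j, k). (- 1) ^ k * (t / sinh_root_sq j) ^ Suc k / real (Suc k))"
  define g where "g = (\<lambda>(j, k). 1 / sinh_root_sq j * t ^ k)"
  have ge1: "sinh_root_sq j \<ge> 1" for j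
  proof -
    have "1 \<le> real (Suc j) ^ 2" by simp
    thus ?thesis using sinh_root_sq_ge[of j] by linarith
  qed
  \<comment> \<open>The dominating double series is a product of two convergent series.\<close>
  have "g summable_on UNIV \<times> UNIV"
  proof (rule summable_on_SigmaI)
    show "((\<lambda>k. g (j, k)) has_sum (1 / sinh_root_sq j * (1 / (1 - t)))) UNIV" for j
      unfolding g_def prod.case using assms
      by (intro has_sum_cmult_right sums_nonneg_imp_has_sum geometric_sums) auto
    have "summable (\<lambda>j. 1 / sinh_root_sq j ^ 1)" using root_power_sum_sums[of 1] by
        (simp add: sums_iff)
    thus "(\<lambda>j. 1 / sinh_root_sq j * (1 / (1 - t))) summable_on UNIV"
      by (intro summable_on_cmult_left summable_nonneg_imp_summable_on) (auto simp: less_imp_le)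
    show "g (j, k) \<ge> 0" for j k using assms by (simp add: g_def less_imp_le)
  qed
  moreover have "norm (f p) \<le> norm (g p)" for p
  proof -
    obtain j k where p: "p = (j, k)" by force
    have "(t / sinh_root_sq j) ^ k \<le> t ^ k" using assms ge1[of j]
      by (intro power_mono) (auto simp: field_simps mult_le_cancel_left1)
    hence "(t / sinh_root_sq j) * (t / sinh_root_sq j) ^ k \<le> (1 / sinh_root_sq j) * t ^ k"
      using assms by (intro mult_mono divide_right_mono) (auto simp: less_imp_le)
    moreover have "(t / sinh_root_sq j) ^ Suc k / real (Suc k) \<le> (t / sinh_root_sq j) ^ Suc k / 1"
      using assms by (intro divide_left_mono) (auto simp: less_imp_le)
    ultimately have "(t / sinh_root_sq j) ^ Suc k / real (Suc k) \<le> 1 / sinh_root_sq j * t ^ k" by simp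
    thus ?thesis using assms by
        (simp add: p f_def g_def abs_mult power_abs less_imp_le del: power_Suc of_nat_Suc)
  qed
  moreover have "(\<lambda>p. norm (g p)) = g"
    using assms by (simp add: g_def fun_eq_iff less_imp_le)
  ultimately have "(\<lambda>p. norm (f p)) summable_on UNIV \<times> UNIV"
    using Infinite_Sum.abs_summable_on_comparison_test[of g "UNIV \<times> UNIV" f] by simp
  hence summable: "f summable_on UNIV \<times> UNIV" by (rule Infinite_Sum.abs_summable_summable)
  from summable obtain S where S: "(f has_sum S) (UNIV \<times> UNIV)" by (auto simp: summable_on_def)
  have "((\<lambda>j. ln (1 + t / sinh_root_sq j)) has_sum S) UNIV"
  proof (rule has_sum_SigmaD[OF S])
    fix j :: nat
    define u where "u = t / sinh_root_sq j"
    have u: "0 \<le> u" "u < 1" using assms ge1[of j] by (auto simp: u_def less_imp_le field_simps)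
    have "(\<lambda>k. f (j, k)) summable_on UNIV"
      by (rule summable_on_SigmaD1[where A = UNIV and B = "\<lambda>_. UNIV"]) (use summable in simp_all)
    hence "((\<lambda>k. f (j, k)) has_sum (\<Sum>\<^sub>\<infinity>k. f (j, k))) UNIV" by (rule has_sum_infsum)
    moreover from has_sum_imp_sums[OF this] have "(\<Sum>\<^sub>\<infinity>k. f (j, k)) = ln (1 + u)"
      using ln1p_series[OF u] sums_unique2 unfolding f_def u_def by auto
    ultimately show "((\<lambda>k. f (j, k)) has_sum ln (1 + t / sinh_root_sq j)) UNIV" by (simp add: u_def)
  qed
  hence "S = F t" using F_sums[OF assms(1)] has_sum_imp_sums sums_unique2 by blast
  have "((\<lambda>(k, j). f (j, k)) has_sum S) (UNIV \<times> UNIV)"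
    using has_sum_reindex_bij_witness[of "UNIV \<times> UNIV" "\<lambda>p. (snd p, fst p)" "\<lambda>p. (snd p, fst p)"
        "UNIV \<times> UNIV" f "\<lambda>(k, j). f (j, k)" S S] S
    by (auto simp: case_prod_unfold)
  hence "((\<lambda>k. (- 1) ^ k / real (Suc k) * root_power_sum (Suc k) * t ^ Suc k) has_sum S) UNIV"
  proof (rule has_sum_SigmaD)
    fix k :: nat
    have "((\<lambda>j. (- 1) ^ k / real (Suc k) * t ^ Suc k * (1 / sinh_root_sq j ^ Suc k)) has_sum
            (- 1) ^ k / real (Suc k) * t ^ Suc k * root_power_sum (Suc k)) UNIV"
      by (intro has_sum_cmult_right sums_nonneg_imp_has_sum root_power_sum_sums)
          (auto simp: less_imp_le)
    thus "((\<lambda>j. case (k, j) of (k, j) \<Rightarrow> f (j, k)) has_sum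
            (- 1) ^ k / real (Suc k) * root_power_sum (Suc k) * t ^ Suc k) UNIV"
      by (simp add: f_def power_divide field_simps del: power_Suc of_nat_Suc)
  qed
  thus ?thesis using \<open>S = F t\<close> has_sum_imp_sums by blast
qed

section \<open>The Taylor coefficients of \<open>F\<close> and Bernoulli numbers\<close>

text \<open>
  The coefficients of \<open>w / (e\<^sup>w - 1)\<close> are determined one after the other by multiplying with
  \<open>e\<^sup>w - 1\<close> and comparing coefficients with those of \<open>w\<close>.
\<close>

lemma bernoulli_values:
  "bernoulli 0 = 1" "bernoulli 2 = 1 / 6" "bernoulli 4 = - 1 / 30" "bernoulli 6 = 1 / 42"
proof -
  define R :: "real fps" where "R = fps_X / (fps_exp 1 - 1)"
  have sub: "subdegree (fps_exp (1::real) - 1) = 1" by (auto intro!: subdegreeI)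
  have ne: "fps_exp (1::real) - 1 \<noteq> 0" using sub by (metis subdegree_0 zero_neq_one)
  have "R * (fps_exp 1 - 1) = fps_X"
    unfolding R_def by (rule dvd_div_mult_self) (use ne sub in \<open>auto simp: fps_dvd_iff\<close>)
  hence *: "(\<Sum>i=0..n. fps_nth R i * fps_nth (fps_exp 1 - 1) (n - i)) = fps_nth fps_X n" for n
    by (metis fps_mult_nth)
  have 0: "fps_nth R 0 = 1" using *[of 1] by simp
  have 1: "fps_nth R 1 = - 1 / 2" using *[of 2] 0 by (simp add: eval_nat_numeral)
  have 2: "fps_nth R 2 = 1 / 12" using *[of 3] 0 1 by (simp add: eval_nat_numeral)
  have 3: "fps_nth R 3 = 0" using *[of 4] 0 1 2 by (simp add: eval_nat_numeral)
  have 4: "fps_nth R 4 = - 1 / 720" using *[of 5] 0 1 2 3 by (simp add: eval_nat_numeral)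
  have 5: "fps_nth R 5 = 0" using *[of 6] 0 1 2 3 4 by (simp add: eval_nat_numeral)
  have 6: "fps_nth R 6 = 1 / 30240" using *[of 7] 0 1 2 3 4 5 by (simp add: eval_nat_numeral)
  have "bernoulli n = fact n * fps_nth R n" for n by (simp add: bernoulli_def R_def)
  thus "bernoulli 0 = 1" "bernoulli 2 = 1 / 6" "bernoulli 4 = - 1 / 30" "bernoulli 6 = 1 / 42"
    using 0 2 4 6 by (simp_all add: fact_numeral)
qed

text \<open>
  Averaging the generating function over \<open>w\<close> and \<open>-w\<close> cancels all terms of odd index, the term of
  \<open>B\<^sub>1\<close> among them, and leaves \<open>(w / 2) coth (w / 2)\<close>.
\<close>

lemma coth_bernoulli_sums:
  fixes x :: real
  assumes "0 < x" "x < pi"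
  shows "(\<lambda>k. bernoulli (2 * k) * (2 * x) ^ (2 * k) / fact (2 * k)) sums (x * cosh x / sinh x)"
proof -
  define w where "w = 2 * x"
  have real_sums: "(\<lambda>m. bernoulli m * v ^ m / fact m) sums (v / (exp v - 1))"
    if "v \<noteq> 0" "\<bar>v\<bar> < 2 * pi" for v :: real
  proof -
    have "(\<lambda>m. of_real (bernoulli m) * of_real v ^ m / fact m)
        sums (of_real v / (exp (of_real v) - 1 :: complex))"
      using that by (intro bernoulli_sums) auto
    also have "(\<lambda>m. of_real (bernoulli m) * of_real v ^ m / fact m)
        = (\<lambda>m. complex_of_real (bernoulli m * v ^ m / fact m))"
      by simp
    also have "of_real v / (exp (of_real v) - 1 :: complex) = of_real (v / (exp v - 1))"
      by (simp add: exp_of_real)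
    finally show ?thesis by (simp only: sums_of_real_iff)
  qed
  have "(\<lambda>m. bernoulli m * w ^ m / fact m + bernoulli m * (- w) ^ m / fact m)
      sums (w / (exp w - 1) + (- w) / (exp (- w) - 1))"
    using assms by (intro sums_add real_sums) (auto simp: w_def)
  hence "(\<lambda>m. (bernoulli m * w ^ m / fact m + bernoulli m * (- w) ^ m / fact m) / 2)
      sums ((w / (exp w - 1) + (- w) / (exp (- w) - 1)) / 2)"
    by (rule sums_divide)
  also have "(w / (exp w - 1) + (- w) / (exp (- w) - 1)) / 2 = x * cosh x / sinh x"
  proof -
    define e where "e = exp x"
    have e: "e > 1" using assms by (simp add: e_def)
    have exp: "exp w = e ^ 2" "exp (- w) = 1 / e ^ 2" "exp (- x) = 1 / e"
      by (simp_all add: e_def w_def exp_double exp_minus inverse_eq_divide)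
    have e2: "e ^ 2 > 1" using e by (simp add: one_less_power)
    have neg: "(- w) / (1 / e ^ 2 - 1) = w * e ^ 2 / (e ^ 2 - 1)"
      using e e2 by (simp add: divide_simps) (simp add: algebra_simps)
    have "(w / (exp w - 1) + (- w) / (exp (- w) - 1)) / 2 = x * ((e ^ 2 + 1) / (e ^ 2 - 1))"
      unfolding exp neg using e2 by (simp add: w_def divide_simps) (simp add: algebra_simps)
    also have "(e ^ 2 + 1) / (e ^ 2 - 1) = cosh x / sinh x"
      unfolding cosh_field_def sinh_field_def exp e_def[symmetric]
      using e e2 by (simp add: divide_simps power2_eq_square)
    finally show ?thesis by simp
  qed
  finally have *: "(\<lambda>m. (bernoulli m * w ^ m / fact m + bernoulli m * (- w) ^ m / fact m) / 2)
      sums (x * cosh x / sinh x)" .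
  have "(\<lambda>k. (bernoulli (2 * k) * w ^ (2 * k) / fact (2 * k) + bernoulli (2 * k) * (- w) ^ (2 * k) / fact (2 * k)) / 2)
      sums (x * cosh x / sinh x)"
  proof (subst sums_mono_reindex[where g = "\<lambda>k. 2 * k"])
    show "(bernoulli m * w ^ m / fact m + bernoulli m * (- w) ^ m / fact m) / 2 = 0"
        if "m \<notin> range (\<lambda>k. 2 * k)" for m
      using that by (cases "even m") (auto elim!: evenE)
  qed (use * in \<open>auto simp: strict_mono_def\<close>)
  thus ?thesis unfolding w_def [symmetric] by simp
qed

text \<open>
  The coefficients of a power series are determined by its values to the right of the centre. The
  difference of the two series is multiplied by \<open>t\<close>, which makes it vanish at \<open>0\<close>, so that a nonzero
  coefficient would make \<open>0\<close> an isolated zero.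
\<close>

lemma power_series_coeff_eqI:
  fixes a b :: "nat \<Rightarrow> real"
  assumes "r > 0"
    and a: "\<And>t. 0 < t \<Longrightarrow> t < r \<Longrightarrow> (\<lambda>n. a n * t ^ n) sums f t"
    and b: "\<And>t. 0 < t \<Longrightarrow> t < r \<Longrightarrow> (\<lambda>n. b n * t ^ n) sums f t"
  shows "a n = b n"
proof (rule ccontr)
  assume "a n \<noteq> b n"
  define d where "d = (\<lambda>k. case k of 0 \<Rightarrow> 0 | Suc m \<Rightarrow> a m - b m)"
  define g where "g = (\<lambda>x. \<Sum>k. d k * x ^ k)"
  have d: "(\<lambda>k. d k * t ^ k) sums 0" if "0 < t" "t < r" for t
  proof -
    have "(\<lambda>m. t * (a m * t ^ m - b m * t ^ m)) sums (t * (f t - f t))"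
      by (intro sums_mult sums_diff a b that)
    hence "(\<lambda>m. d (Suc m) * t ^ Suc m) sums 0" by (simp add: d_def algebra_simps)
    thus ?thesis by (subst (asm) sums_Suc_iff) (simp add: d_def)
  qed
  have g: "(\<lambda>k. d k * (x - 0) ^ k) sums g x" if "norm (x - 0) < r / 2" for x
    unfolding g_def diff_0_right
    by (rule summable_sums, rule powser_inside[of d "r / 2"]) (use d[of "r / 2"] assms(1) that
        in \<open>auto simp: sums_iff\<close>)
  have "g 0 = 0" by (simp add: g_def d_def)
  moreover have "d (Suc n) \<noteq> 0" using \<open>a n \<noteq> b n\<close> by (simp add: d_def)
  ultimately obtain s where s: "0 < s" "\<And>z. z \<in> cball 0 s - {0} \<Longrightarrow> g z \<noteq> 0"
    using powser_0_nonzero[of "r / 2" 0 d g "Suc n"] g assms(1) by auto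
  define z where "z = min s (r / 2)"
  have "g z = 0" unfolding g_def using d[of z] s(1) assms(1) by (auto simp: z_def sums_iff)
  moreover have "g z \<noteq> 0" using s assms(1) by (intro s(2)) (auto simp: z_def)
  ultimately show False by contradiction
qed

lemma F_has_real_derivative:
  assumes "t > 0"
  shows "(F has_real_derivative (sqrt t * cosh (sqrt t) / sinh (sqrt t) - 1) / (2 * t)) (at t)"
proof -
  have "((\<lambda>t. ln (sinh (sqrt t)) - ln (sqrt t)) has_real_derivative
      cosh (sqrt t) * (inverse (sqrt t) / 2) / sinh (sqrt t) - inverse (sqrt t) / 2 / sqrt t) (at t)"
    using assms by (auto intro!: derivative_eq_intros)
  also have "cosh (sqrt t) * (inverse (sqrt t) / 2) / sinh (sqrt t) - inverse (sqrt t) / 2 / sqrt t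
      = (sqrt t * cosh (sqrt t) / sinh (sqrt t) - 1) / (2 * t)"
  proof -
    define x where "x = sqrt t"
    have "t = x * x" "x > 0" using assms by (simp_all add: x_def)
    thus ?thesis unfolding x_def[symmetric] by (simp add: divide_simps)
  qed
  finally show ?thesis
  proof (rule has_field_derivative_transform_within_open)
    show "ln (sinh (sqrt u)) - ln (sqrt u) = F u" if "u \<in> {0<..}" for u
      using that by (simp add: F_eq_ln_sinh_sqrt ln_div)
  qed (use assms in auto)
qed

text \<open>
  This is Euler's evaluation of \<open>\<zeta>(2k + 2)\<close>. Both sides are, up to the same factor, the Taylor
  coefficients of the derivative of \<open>F\<close>: the right-hand side comes from the expansion over the zeros
  of \<open>sinh\<close>, the left-hand side from the expansion of \<open>\<surd>t coth \<surd>t\<close>. Comparing derivatives rather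
  than \<open>F\<close> itself avoids a constant of integration.
\<close>

lemma bernoulli_eq_root_power_sum:
  "2 ^ (2 * Suc k) * bernoulli (2 * Suc k) / fact (2 * Suc k)
      = 2 * (- 1) ^ k * root_power_sum (Suc k)"
proof -
  define a where "a = (\<lambda>n. case n of 0 \<Rightarrow> 0 | Suc k \<Rightarrow> (- 1) ^ k / real (Suc k) * root_power_sum (Suc k))"
  define b where "b = (\<lambda>k. 2 ^ (2 * k) * bernoulli (2 * k) / fact (2 * k))"
  define f where "f = (\<lambda>t. \<Sum>n. a n * t ^ n)"
  define F' where "F' = (\<lambda>t::real. (sqrt t * cosh (sqrt t) / sinh (sqrt t) - 1) / (2 * t))"
  have a_sums: "(\<lambda>n. a n * t ^ n) sums F t" if "0 < t" "t < 1" for t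
    using F_power_series[OF that] sums_Suc_iff[of "\<lambda>n. a n * t ^ n" "F t"] by (simp add: a_def)
  have diffs_sums: "(\<lambda>n. diffs a n * t ^ n) sums F' t" if t: "0 < t" "t < 1" for t
  proof (rule termdiffs_sums_strong[where K = "(t + 1) / 2" and f = f])
    show "(\<lambda>n. a n * z ^ n) sums f z" if "norm z < (t + 1) / 2" for z
      unfolding f_def
      by (rule summable_sums, rule powser_inside[of a "(t + 1) / 2"])
         (use a_sums[of "(t + 1) / 2"] t that in \<open>auto simp: sums_iff\<close>)
    have "(F has_real_derivative F' t) (at t)" unfolding F'_def using t
        by (intro F_has_real_derivative) auto
    thus "(f has_real_derivative F' t) (at t)"
    proof (rule has_field_derivative_transform_within_open)
      show "F z = f z" if "z \<in> {0<..<1}"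
          for z using a_sums[of z] that by (auto simp: f_def sums_iff)
    qed (use t in auto)
  qed (use t in auto)
  have b0: "b 0 = 1" by (simp add: b_def bernoulli_values)
  have b_sums: "(\<lambda>n. b (Suc n) / 2 * t ^ n) sums F' t" if t: "0 < t" "t < 1" for t
  proof -
    have "sqrt t < 1" using t by simp
    hence "sqrt t < pi" using pi_gt3 by linarith
    hence "(\<lambda>k. bernoulli (2 * k) * (2 * sqrt t) ^ (2 * k) / fact (2 * k))
        sums (sqrt t * cosh (sqrt t) / sinh (sqrt t))"
      using t by (intro coth_bernoulli_sums) auto
    also have "(\<lambda>k. bernoulli (2 * k) * (2 * sqrt t) ^ (2 * k) / fact (2 * k)) = (\<lambda>k. b k * t ^ k)"
      using t by (simp add: b_def power_mult_distrib power_mult fun_eq_iff)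
    finally have "(\<lambda>k. b (Suc k) * t ^ Suc k) sums (sqrt t * cosh (sqrt t) / sinh (sqrt t) - 1)"
      by (subst sums_Suc_iff) (simp add: b0)
    from sums_divide[OF this, of "2 * t"] show ?thesis using t by (simp add: F'_def)
  qed
  have "diffs a k = b (Suc k) / 2"
    using power_series_coeff_eqI[of 1 "diffs a" F' "\<lambda>n. b (Suc n) / 2"] diffs_sums b_sums by auto
  moreover have "diffs a k = (- 1) ^ k * root_power_sum (Suc k)"
    by (simp add: diffs_def a_def del: of_nat_Suc)
  ultimately have "b (Suc k) = 2 * (- 1) ^ k * root_power_sum (Suc k)" by simp
  thus ?thesis by (simp only: b_def)
qed

text \<open>
  The Taylor polynomial of \<open>F\<close> is the sum of the Taylor polynomials of the summands
  \<open>ln (1 + t / sinh_root_sq j)\<close>. Hence the remainder of \<open>F\<close> is the sum of their remainders, and this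
  for all \<open>t > 0\<close>, beyond the disc of convergence of the Taylor series.
\<close>

lemma ln1p_remainder_sums:
  assumes "t > 0"
  shows "(\<lambda>j. ln1p_remainder n (t / sinh_root_sq j)) sums (F t - F_part n t)"
proof -
  have "(\<lambda>j. \<Sum>k<n. (- 1) ^ k * (t / sinh_root_sq j) ^ Suc k / real (Suc k)) sums
          (\<Sum>k<n. (- 1) ^ k * t ^ Suc k / real (Suc k) * root_power_sum (Suc k))"
  proof (rule sums_sum)
    fix k
    have "(\<lambda>j. (- 1) ^ k * t ^ Suc k / real (Suc k) * (1 / sinh_root_sq j ^ Suc k)) sums
        ((- 1) ^ k * t ^ Suc k / real (Suc k) * root_power_sum (Suc k))"
      by (intro sums_mult root_power_sum_sums) auto
    thus "(\<lambda>j. (- 1) ^ k * (t / sinh_root_sq j) ^ Suc k / real (Suc k)) sums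
        ((- 1) ^ k * t ^ Suc k / real (Suc k) * root_power_sum (Suc k))"
      by (simp add: power_divide mult_ac del: power_Suc of_nat_Suc)
  qed
  also have "(\<Sum>k<n. (- 1) ^ k * t ^ Suc k / real (Suc k) * root_power_sum (Suc k)) = F_part n t"
    unfolding F_part_def One_nat_def sum.atLeast1_atMost_eq
  proof (intro sum.cong refl)
    fix k
    have "2 ^ (2 * Suc k) * bernoulli (2 * Suc k) / (2 * real (Suc k) * fact (2 * Suc k)) * t ^ Suc k =
        (2 ^ (2 * Suc k) * bernoulli (2 * Suc k) / fact (2 * Suc k)) / (2 * real (Suc k)) * t ^ Suc k"
      by (simp only: divide_divide_eq_left mult_ac)
    also have "\<dots> = (- 1) ^ k * t ^ Suc k / real (Suc k) * root_power_sum (Suc k)"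
      unfolding bernoulli_eq_root_power_sum by (simp del: of_nat_Suc power_Suc)
    finally show "(- 1) ^ k * t ^ Suc k / real (Suc k) * root_power_sum (Suc k) =
        2 ^ (2 * Suc k) * bernoulli (2 * Suc k) / (2 * real (Suc k) * fact (2 * Suc k)) * t ^ Suc k" by simp
  qed
  finally show ?thesis unfolding ln1p_remainder_def using sums_diff[OF F_sums[OF assms]] by blast
qed

section \<open>The zeta function as a Mellin transform\<close>

lemma zeta_sums:
  assumes "Re z > 1"
  shows "summable (\<lambda>k. norm (complex_of_nat (Suc k) powr (- z)))"
    and "(\<lambda>k. complex_of_nat (Suc k) powr (- z)) sums zeta z"
proof -
  have norm: "norm (complex_of_nat k powr (- z)) = real k powr (- Re z)" for k
    using norm_powr_real_powr[of "complex_of_nat k" "- z"] by simp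
  have "summable (\<lambda>k. real k powr (- Re z))" using assms by (subst summable_real_powr_iff) auto
  thus *: "summable (\<lambda>k. norm (complex_of_nat (Suc k) powr (- z)))"
    unfolding norm by (subst summable_Suc_iff)
  show "(\<lambda>k. complex_of_nat (Suc k) powr (- z)) sums zeta z"
    unfolding zeta_def using summable_norm_cancel[OF *] by (rule summable_sums)
qed

lemma sinh_root_sq_powr:
  "complex_of_real (sinh_root_sq j) powr (- z / 2)
      = of_real pi powr (- z) * of_nat (Suc j) powr (- z)"
proof -
  have ln: "ln (sinh_root_sq j) = 2 * ln pi + 2 * ln (real (Suc j))"
    by (simp add: sinh_root_sq_def ln_realpow ln_mult)
  have "complex_of_nat (Suc j) = complex_of_real (real (Suc j))" by simp
  thus ?thesis
    by (simp only: of_real_powr_eq_exp_ln[OF sinh_root_sq_pos] of_real_powr_eq_exp_ln[OF pi_gt_zero]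
        of_real_powr_eq_exp_ln[of "real (Suc j)"] of_nat_0_less_iff zero_less_Suc ln flip: exp_add)
       (simp add: algebra_simps)
qed

text \<open>
  The remainder of \<open>F\<close> is a superposition of dilates of \<open>ln1p_remainder n\<close> with respect to counting
  measure, and the Dirichlet series of the dilation factors at \<open>-z / 2\<close> is
  \<open>\<pi>\<^sup>-\<^sup>z \<zeta>(z)\<close>. The lower bound \<open>Re z > 1\<close> makes this series absolutely convergent.
\<close>

lemma has_mellin_F_remainder:
  assumes "real (max (2 * n) 1) < Re z" "Re z < 2 * real n + 2"
  shows "has_mellin (\<lambda>t. F t - F_part n t) (- z / 2)
     (of_real pi powr (- z) * zeta z * (of_real pi / (z / 2 * sin (of_real pi * z / 2))))"
proof -
  have z: "Re z > 1" using assms by auto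
  define S where "S = (count_space UNIV :: nat measure)"
  have "has_mellin (\<lambda>t. LINT j|S. ln1p_remainder n (t / sinh_root_sq j) * 1) (- z / 2)
     (of_real pi powr (- z) * zeta z * (of_real pi / (- z / 2 * sin (of_real pi * (- z / 2)))))"
  proof (rule mellin_superposition)
    show "has_mellin (ln1p_remainder n) (- z / 2) (of_real pi / (- z / 2 * sin (of_real pi * (- z / 2))))"
      using assms by (intro has_mellin_ln1p_remainder) auto
    have "integrable S (\<lambda>j. complex_of_nat (Suc j) powr (- z))"
      unfolding S_def by (subst integrable_count_space_nat_iff) (rule zeta_sums(1)[OF z])
    moreover from this have "(LINT j|S. complex_of_nat (Suc j) powr (- z)) = zeta z"
      using sums_integral_count_space_nat zeta_sums(2)[OF z] sums_unique2 unfolding S_def by blast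
    ultimately have "has_bochner_integral S (\<lambda>j. complex_of_nat (Suc j) powr (- z)) (zeta z)"
      by (simp add: has_bochner_integral_iff)
    from has_bochner_integral_mult_right[OF this, of "of_real pi powr (- z)"]
    show "has_bochner_integral S (\<lambda>j. of_real (sinh_root_sq j) powr (- z / 2) * complex_of_real 1)
        (of_real pi powr (- z) * zeta z)"
      by (simp only: sinh_root_sq_powr of_real_1 mult_1_right)
  qed (auto simp: S_def intro: sigma_finite_measure_count_space)
  also have "?this \<longleftrightarrow> ?thesis"
  proof (rule has_mellin_cong)
    fix t :: real assume t: "t > 0"
    have sums: "(\<lambda>j. ln1p_remainder n (t / sinh_root_sq j)) sums (F t - F_part n t)"
      by (rule ln1p_remainder_sums[OF t])
    have "\<bar>ln1p_remainder n (t / sinh_root_sq j)\<bar>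
        = (- 1) ^ n * ln1p_remainder n (t / sinh_root_sq j)" for j
      using t by (intro ln1p_remainder_sign) (auto simp: less_imp_le)
    hence "summable (\<lambda>j. \<bar>ln1p_remainder n (t / sinh_root_sq j)\<bar>)"
      using sums_summable[OF sums_mult[OF sums, of "(- 1) ^ n"]] by simp
    hence "integrable S (\<lambda>j. ln1p_remainder n (t / sinh_root_sq j))"
      unfolding S_def by (subst integrable_count_space_nat_iff) simp
    hence "(LINT j|S. ln1p_remainder n (t / sinh_root_sq j)) = F t - F_part n t"
      using sums_integral_count_space_nat sums sums_unique2 unfolding S_def by blast
    thus "(LINT j|S. ln1p_remainder n (t / sinh_root_sq j) * 1) = F t - F_part n t" by simp
  qed auto
  finally show ?thesis .
qed

text \<open>
  The formula for the transform can be solved for \<open>\<zeta>(z)\<close> because the strip contains no even integer,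
  so that the sine does not vanish.
\<close>

lemma zeta_eq_mellin:
  assumes "real (max (2 * n) 1) < Re z" "Re z < 2 * real n + 2"
  defines "f \<equiv> \<lambda>t. of_real t powr (- z / 2 - 1) * complex_of_real (F t - F_part n t)"
  shows "set_integrable lborel {0<..} f"
    and "zeta z = (z / 2) * of_real pi powr (z - 1) * sin (of_real pi * z / 2) * (LINT t:{0<..}|lborel. f t)"
proof -
  have b: "has_bochner_integral lborel (\<lambda>t. indicator {0<..} t *\<^sub>R f t)
     (of_real pi powr (- z) * zeta z * (of_real pi / (z / 2 * sin (of_real pi * z / 2))))"
    using has_mellin_F_remainder[OF assms(1,2)] unfolding has_mellin_def f_def .
  thus "set_integrable lborel {0<..} f" by (simp add: set_integrable_def has_bochner_integral_iff)
  have int: "(LINT t:{0<..}|lborel. f t)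
      = of_real pi powr (- z) * zeta z * (of_real pi / (z / 2 * sin (of_real pi * z / 2)))"
    using b by (simp add: set_lebesgue_integral_def has_bochner_integral_iff)
  have z0: "z \<noteq> 0" using assms by auto
  have s0: "sin (of_real pi * z / 2) \<noteq> 0"
  proof
    assume "sin (of_real pi * z / 2) = 0"
    then obtain m :: int where "of_real pi * z / 2 = of_real (of_int m * pi)"
      by (auto simp: sin_eq_0)
    hence "z = of_int (2 * m)" by (simp add: field_simps)
    hence "Re z = of_int (2 * m)" by simp
    hence "real_of_int (int (2 * n)) < of_int (2 * m)"
        "of_int (2 * m) < real_of_int (int (2 * n + 2))"
      using assms by auto
    thus False unfolding of_int_less_iff by presburger
  qed
  have "of_real pi powr (z - 1) * (of_real pi powr (- z) * of_real pi) = (1 :: complex)"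
    by (simp add: powr_diff powr_minus field_simps)
  thus "zeta z = (z / 2) * of_real pi powr (z - 1) * sin (of_real pi * z / 2) * (LINT t:{0<..}|lborel. f t)"
    unfolding int using z0 s0 by (simp add: field_simps)
qed

section \<open>Values at odd integers\<close>

lemma set_integral_square_substitution:
  fixes g :: "real \<Rightarrow> real"
  assumes "set_integrable lborel {0<..} g"
  shows "set_integrable lborel {0<..} (\<lambda>s. 2 * s * g (s\<^sup>2))"
    and "(LINT s:{0<..}|lborel. 2 * s * g (s\<^sup>2)) = (LINT t:{0<..}|lborel. g t)"
proof -
  define G where "G = (\<lambda>t. indicator {0<..} t *\<^sub>R g t)"
  define H where "H = (\<lambda>s. indicator {0<..} s *\<^sub>R (2 * s * g (s\<^sup>2)))"
  have Gint: "integrable lborel G" using assms by (simp add: set_integrable_def G_def)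
  hence [measurable]: "G \<in> borel_measurable borel" by auto
  have "H = (\<lambda>s. indicator {0<..} s * (2 * s * G (s\<^sup>2)))"
    by (auto simp: H_def G_def fun_eq_iff indicator_def)
  also have "\<dots> \<in> borel_measurable borel" by measurable
  finally have [measurable]: "H \<in> borel_measurable borel" .
  have g: "g absolutely_integrable_on {0<..}"
    unfolding set_integrable_def G_def[symmetric] using Gint by (simp add: integrable_completion)
  have img: "(\<lambda>s::real. s\<^sup>2) ` {0<..} = {0<..}"
  proof safe
    fix t :: real assume "t > 0"
    thus "t \<in> (\<lambda>s. s\<^sup>2) ` {0<..}" by (intro image_eqI[of _ _ "sqrt t"]) auto
  qed auto
  have "(\<lambda>s. \<bar>2 * s\<bar> * g (s\<^sup>2)) absolutely_integrable_on {0<..} \<and>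
        integral {0<..} (\<lambda>s. \<bar>2 * s\<bar> * g (s\<^sup>2)) = integral {0<..} g \<longleftrightarrow>
      g absolutely_integrable_on (\<lambda>s. s\<^sup>2) ` {0<..} \<and> integral ((\<lambda>s. s\<^sup>2) ` {0<..}) g
          = integral {0<..} g"
    by (rule has_absolute_integral_change_of_variables_1')
       (auto intro!: derivative_eq_intros simp: inj_on_def)
  hence cov: "(\<lambda>s. \<bar>2 * s\<bar> * g (s\<^sup>2)) absolutely_integrable_on {0<..}"
      "integral {0<..} (\<lambda>s. \<bar>2 * s\<bar> * g (s\<^sup>2)) = integral {0<..} g"
    using g unfolding img by blast+
  from cov(1) have h: "set_integrable lebesgue {0<..} (\<lambda>s. \<bar>2 * s\<bar> * g (s\<^sup>2))" by blast
  have H': "(\<lambda>s. indicator {0<..} s *\<^sub>R (\<bar>2 * s\<bar> * g (s\<^sup>2))) = H"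
    by (auto simp: H_def fun_eq_iff indicator_def)
  have "integrable lebesgue H" using h unfolding set_integrable_def H' .
  thus "set_integrable lborel {0<..} (\<lambda>s. 2 * s * g (s\<^sup>2))"
    unfolding set_integrable_def H_def[symmetric] by (simp add: integrable_completion)
  have "(LINT s:{0<..}|lborel. 2 * s * g (s\<^sup>2)) = integral\<^sup>L lebesgue H"
    unfolding set_lebesgue_integral_def H_def[symmetric] by (simp add: integral_completion)
  also have "\<dots> = integral {0<..} (\<lambda>s. \<bar>2 * s\<bar> * g (s\<^sup>2))"
    using set_lebesgue_integral_eq_integral(2)[OF h] unfolding set_lebesgue_integral_def H' .
  also have "\<dots> = integral {0<..} g" by (rule cov(2))
  also have "\<dots> = integral\<^sup>L lebesgue G"
    using set_lebesgue_integral_eq_integral(2)[OF g] by (simp add: set_lebesgue_integral_def G_def)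
  also have "\<dots> = (LINT t:{0<..}|lborel. g t)"
    unfolding set_lebesgue_integral_def G_def[symmetric] by (simp add: integral_completion)
  finally show "(LINT s:{0<..}|lborel. 2 * s * g (s\<^sup>2)) = (LINT t:{0<..}|lborel. g t)" .
qed

lemma zeta_odd_integral:
  assumes n: "n \<ge> 1"
  defines "h \<equiv> \<lambda>s. s powi (- int (2 * n + 2)) * (F (s\<^sup>2) - F_part n (s\<^sup>2))"
  shows "set_integrable lborel {0<..} h"
    and "zeta (of_nat (2 * n + 1)) =
      of_real ((- 1) ^ n * real (2 * n + 1) * pi ^ (2 * n) * (LINT s:{0<..}|lborel. h s))"
proof -
  define z :: complex where "z = of_nat (2 * n + 1)"
  define e where "e = - real (2 * n + 1) / 2 - 1"
  define g where "g = (\<lambda>t. t powr e * (F t - F_part n t))"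
  have z: "real (max (2 * n) 1) < Re z" "Re z < 2 * real n + 2" using n by (auto simp: z_def)
  have e: "- z / 2 - 1 = of_real e" by (simp add: z_def e_def)
  have g: "of_real t powr (- z / 2 - 1) * complex_of_real (F t - F_part n t) = of_real (g t)"
      if "t \<in> {0<..}" for t
    unfolding e using that powr_of_real[of t e] by (simp add: g_def)
  have "set_integrable lborel {0<..} (\<lambda>t. complex_of_real (g t))"
    using zeta_eq_mellin(1)[OF z] by (subst (asm) set_integrable_cong[OF refl refl g]) auto
  hence "integrable lborel (\<lambda>t. complex_of_real (indicator {0<..} t * g t))"
    by (simp add: set_integrable_def scaleR_conv_of_real)
  hence gint: "set_integrable lborel {0<..} g"
    unfolding set_integrable_def complex_of_real_integrable_eq by simp
  have gh: "2 * s * g (s\<^sup>2) = 2 * h s" if "s \<in> {0<..}" for s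
  proof -
    have s: "s > 0" using that by simp
    have "s * (s\<^sup>2) powr e = s powr (1 + 2 * e)"
      using s by (simp add: powr_add powr_powr flip: powr_numeral)
    also have "1 + 2 * e = real_of_int (- int (2 * n + 2))" by (simp add: e_def field_simps)
    also have "s powr real_of_int (- int (2 * n + 2)) = s powi (- int (2 * n + 2))"
      using s by (intro powr_real_of_int') auto
    finally show ?thesis by (simp add: g_def h_def)
  qed
  \<comment> \<open>The substitution \<open>t = s\<^sup>2\<close> has turned \<open>t\<^sup>-\<^sup>n\<^sup>-\<^sup>3\<^sup>/\<^sup>2 dt\<close> into \<open>2 s\<^sup>-\<^sup>2\<^sup>n\<^sup>-\<^sup>2 ds\<close>.\<close>
  have "set_integrable lborel {0<..} (\<lambda>s. 2 * h s)"
    using set_integral_square_substitution(1)[OF gint]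
        by (subst (asm) set_integrable_cong[OF refl refl gh]) auto
  thus "set_integrable lborel {0<..} h" by simp
  have int: "(LINT t:{0<..}|lborel. g t) = 2 * (LINT s:{0<..}|lborel. h s)"
  proof -
    have "(LINT t:{0<..}|lborel. g t) = (LINT s:{0<..}|lborel. 2 * s * g (s\<^sup>2))"
      by (rule set_integral_square_substitution(2)[OF gint, symmetric])
    also have "\<dots> = (LINT s:{0<..}|lborel. 2 * h s)"
      using gh by (intro set_lebesgue_integral_cong) auto
    finally show ?thesis by simp
  qed
  have sin: "sin (of_real pi * z / 2) = (- 1) ^ n"
  proof -
    have "of_real pi * z / 2 = of_real (real n * pi + pi / 2)"
      by (simp add: z_def field_simps)
    thus ?thesis by (simp only: sin_of_real sin_add) simp
  qed
  have pi: "of_real pi powr (z - 1) = of_real (pi ^ (2 * n))"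
  proof -
    have "z - 1 = of_nat (2 * n)" by (simp add: z_def)
    thus ?thesis using n powr_nat'[of "of_real pi" "2 * n"] by simp
  qed
  have "(LINT t:{0<..}|lborel. of_real t powr (- z / 2 - 1) * complex_of_real (F t - F_part n t)) =
      (LINT t:{0<..}|lborel. complex_of_real (g t))"
    using g by (intro set_lebesgue_integral_cong) auto
  hence "zeta z = (z / 2) * of_real (pi ^ (2 * n)) * (- 1) ^ n * of_real (2 * (LINT s:{0<..}|lborel. h s))"
    using zeta_eq_mellin(2)[OF z] unfolding sin pi set_integral_complex_of_real int by simp
  thus "zeta (of_nat (2 * n + 1)) =
      of_real ((- 1) ^ n * real (2 * n + 1) * pi ^ (2 * n) * (LINT s:{0<..}|lborel. h s))"
    by (simp add: z_def mult_ac)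
qed

lemma F_power2:
  assumes "s > 0"
  shows "F (s\<^sup>2) = ln (s powi (- 1) * sinh s)"
  using assms by (simp add: F_eq_ln_sinh_sqrt power_int_minus field_simps)

lemma F_part_power2:
  "F_part 1 (s\<^sup>2) = s ^ 2 / 6"
  "F_part 2 (s\<^sup>2) = s ^ 2 / 6 - s ^ 4 / 180"
  "F_part 3 (s\<^sup>2) = s ^ 2 / 6 - s ^ 4 / 180 + s ^ 6 / 2835"
proof -
  have set: "{1..2::nat} = {1, 2}" "{1..3::nat} = {1, 2, 3}" by auto
  show "F_part 1 (s\<^sup>2) = s ^ 2 / 6"
    "F_part 2 (s\<^sup>2) = s ^ 2 / 6 - s ^ 4 / 180"
    "F_part 3 (s\<^sup>2) = s ^ 2 / 6 - s ^ 4 / 180 + s ^ 6 / 2835"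
    unfolding F_part_def set by (simp_all add: bernoulli_values fact_numeral flip: power_mult)
qed

text \<open>
  The explicit integrands of the special cases arrange their terms in different ways; the parameter
  \<open>q\<close> accommodates them all.
\<close>

lemma zeta_odd_sinh_integral:
  assumes n: "n \<ge> 1" and q: "\<And>s. q s = ln (s powi (- 1) * sinh s) - F_part n (s\<^sup>2)"
  defines "h \<equiv> \<lambda>s. s powi (- int (2 * n + 2)) * q s"
  shows "set_integrable lborel {0<..} h"
    and "zeta (of_nat (2 * n + 1)) =
      of_real ((- 1) ^ n * real (2 * n + 1) * pi ^ (2 * n) * (LINT s:{0<..}|lborel. h s))"
proof -
  have eq: "s powi (- int (2 * n + 2)) * (F (s\<^sup>2) - F_part n (s\<^sup>2)) = h s" if "s \<in> {0<..}" for s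
    using that by (simp only: h_def F_power2 q greaterThan_iff)
  show "set_integrable lborel {0<..} h"
    using zeta_odd_integral(1)[OF n] by (subst (asm) set_integrable_cong[OF refl refl eq]) auto
  have "(LINT s:{0<..}|lborel. s powi (- int (2 * n + 2)) * (F (s\<^sup>2) - F_part n (s\<^sup>2)))
      = (LINT s:{0<..}|lborel. h s)"
    using eq by (intro set_lebesgue_integral_cong) auto
  thus "zeta (of_nat (2 * n + 1)) =
      of_real ((- 1) ^ n * real (2 * n + 1) * pi ^ (2 * n) * (LINT s:{0<..}|lborel. h s))"
    using zeta_odd_integral(2)[OF n] by simp
qed

theorem theorem2p10:
  shows
    "(\<forall>(n::nat) (z::complex). real (max (2 * n) 1) < Re z \<and> Re z < 2 * real n + 2 \<longrightarrow>
        set_integrable lborel {0<..}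
          (\<lambda>t::real. of_real t powr (- z / 2 - 1) * of_real (F t - F_part n t)) \<and>
        zeta z = (z / 2) * of_real pi powr (z - 1) * sin (of_real pi * z / 2) *
          (LINT t:{0<..}|lborel. of_real t powr (- z / 2 - 1) * of_real (F t - F_part n t)))
     \<and>
     (set_integrable lborel {0<..} (\<lambda>s::real. s powi (- 4) * (F (s ^ 2) - F_part 1 (s ^ 2))) \<and>
      set_integrable lborel {0<..} (\<lambda>s::real. s powi (- 4) * (ln (s powi (- 1) * sinh s) - s ^ 2 / 6)) \<and>
      zeta 3 = of_real (- 3 * pi ^ 2 *
        (LINT s:{0<..}|lborel. s powi (- 4) * (F (s ^ 2) - F_part 1 (s ^ 2)))) \<and>
      zeta 3 = of_real (- 3 * pi ^ 2 *
        (LINT s:{0<..}|lborel. s powi (- 4) * (ln (s powi (- 1) * sinh s) - s ^ 2 / 6))))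
     \<and>
     (set_integrable lborel {0<..} (\<lambda>s::real. s powi (- 6) * (F (s ^ 2) - F_part 2 (s ^ 2))) \<and>
      set_integrable lborel {0<..}
        (\<lambda>s::real. s powi (- 6) * (ln (s powi (- 1) * sinh s) - s ^ 2 / 6 + s ^ 4 / 180)) \<and>
      zeta 5 = of_real (5 * pi ^ 4 *
        (LINT s:{0<..}|lborel. s powi (- 6) * (F (s ^ 2) - F_part 2 (s ^ 2)))) \<and>
      zeta 5 = of_real (5 * pi ^ 4 *
        (LINT s:{0<..}|lborel.
           s powi (- 6) * (ln (s powi (- 1) * sinh s) - s ^ 2 / 6 + s ^ 4 / 180))))
     \<and>
     (set_integrable lborel {0<..} (\<lambda>s::real. s powi (- 8) * (F (s ^ 2) - F_part 3 (s ^ 2))) \<and>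
      set_integrable lborel {0<..}
        (\<lambda>s::real. s powi (- 8) *
           (ln (s powi (- 1) * sinh s) - s ^ 2 / 6 + s ^ 4 / 180 - s ^ 6 / 2835)) \<and>
      zeta 7 = of_real (- 7 * pi ^ 6 *
        (LINT s:{0<..}|lborel. s powi (- 8) * (F (s ^ 2) - F_part 3 (s ^ 2)))) \<and>
      zeta 7 = of_real (- 7 * pi ^ 6 *
        (LINT s:{0<..}|lborel. s powi (- 8) *
           (ln (s powi (- 1) * sinh s) - s ^ 2 / 6 + s ^ 4 / 180 - s ^ 6 / 2835))))"
proof (intro conjI allI impI; (elim conjE)?)
  fix n :: nat and z :: complex
  assume z: "real (max (2 * n) 1) < Re z" "Re z < 2 * real n + 2"
  show "set_integrable lborel {0<..}
          (\<lambda>t::real. of_real t powr (- z / 2 - 1) * of_real (F t - F_part n t) :: complex)"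
    by (rule zeta_eq_mellin(1)[OF z])
  show "zeta z = (z / 2) * of_real pi powr (z - 1) * sin (of_real pi * z / 2) *
          (LINT t:{0<..}|lborel. of_real t powr (- z / 2 - 1) * of_real (F t - F_part n t))"
    by (rule zeta_eq_mellin(2)[OF z])
next
  let ?h = "\<lambda>s::real. s powi (- 4) * (F (s ^ 2) - F_part 1 (s ^ 2))"
  let ?q = "\<lambda>s::real. ln (s powi (- 1) * sinh s) - s ^ 2 / 6"
  let ?k = "\<lambda>s. s powi (- 4) * ?q s"
  have q: "?q s = ln (s powi (- 1) * sinh s) - F_part 1 (s\<^sup>2)" for s
    unfolding F_part_power2 by simp
  show "set_integrable lborel {0<..} ?h" "zeta 3
      = of_real (- 3 * pi ^ 2 * (LINT s:{0<..}|lborel. ?h s))"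
    using zeta_odd_integral[of 1] by simp_all
  show "set_integrable lborel {0<..} ?k" "zeta 3
      = of_real (- 3 * pi ^ 2 * (LINT s:{0<..}|lborel. ?k s))"
    using zeta_odd_sinh_integral[of 1 ?q, OF _ q] by simp_all
next
  let ?h = "\<lambda>s::real. s powi (- 6) * (F (s ^ 2) - F_part 2 (s ^ 2))"
  let ?q = "\<lambda>s::real. ln (s powi (- 1) * sinh s) - s ^ 2 / 6 + s ^ 4 / 180"
  let ?k = "\<lambda>s. s powi (- 6) * ?q s"
  have q: "?q s = ln (s powi (- 1) * sinh s) - F_part 2 (s\<^sup>2)" for s
    unfolding F_part_power2 by simp
  show "set_integrable lborel {0<..} ?h" "zeta 5
      = of_real (5 * pi ^ 4 * (LINT s:{0<..}|lborel. ?h s))"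
    using zeta_odd_integral[of 2] by simp_all
  show "set_integrable lborel {0<..} ?k" "zeta 5
      = of_real (5 * pi ^ 4 * (LINT s:{0<..}|lborel. ?k s))"
    using zeta_odd_sinh_integral[of 2 ?q, OF _ q] by simp_all
next
  let ?h = "\<lambda>s::real. s powi (- 8) * (F (s ^ 2) - F_part 3 (s ^ 2))"
  let ?q = "\<lambda>s::real. ln (s powi (- 1) * sinh s) - s ^ 2 / 6 + s ^ 4 / 180 - s ^ 6 / 2835"
  let ?k = "\<lambda>s. s powi (- 8) * ?q s"
  have q: "?q s = ln (s powi (- 1) * sinh s) - F_part 3 (s\<^sup>2)" for s
    unfolding F_part_power2 by simp
  show "set_integrable lborel {0<..} ?h" "zeta 7
      = of_real (- 7 * pi ^ 6 * (LINT s:{0<..}|lborel. ?h s))"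
    using zeta_odd_integral[of 3] by simp_all
  show "set_integrable lborel {0<..} ?k" "zeta 7
      = of_real (- 7 * pi ^ 6 * (LINT s:{0<..}|lborel. ?k s))"
    using zeta_odd_sinh_integral[of 3 ?q, OF _ q] by simp_all
qed

end
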